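(* Let $\xi,\eta\in\mathbb R$ and let $\alpha\in\mathbb R$ satisfy $\tan\alpha=\eta/\xi$. Let $\epsilon(x,t)$ be determined by the implicit equation $$\epsilon(x,t)=\frac{\eta}{\xi^2+\eta^2}\Big[\tanh\big(2\eta(x-4\xi t+\epsilon(x,t))\big)+1\Big],$$ and set $$q(x,t)=2i\frac{\eta}{\sqrt{\xi^2+\eta^2}}\,e^{-i\left(-2\xi(x+\epsilon(x,t))+4(\xi^2-\eta^2)t\right)}\,\frac{\cosh\big(2\eta(x+\epsilon(x,t))-8\xi\eta t+i\alpha\big)}{\cosh^2\big(2\eta(x+\epsilon(x,t))-8\xi\eta t\big)-\frac{2\eta^2}{\xi^2+\eta^2}} .$$ (i) If $|\xi|>|\eta|>0$, then $q$ is a smooth (one soliton) solution of the Wadati-Konno-Ichikawa equation $$iq_t+\left(\frac{q}{\sqrt{1+|q|^2}}\right)_{xx}=0 .$$ (ii) If $|\xi|=|\eta|>0$, then the formula gives a bursting soliton: for every $t$, the maximum height of $|q(\cdot,t)|$ is infinite, i.e. $|q(\cdot,t)|$ is unbounded.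
   Context: $q$ is a complex-valued function of $x\in\mathbb R$ and $t\ge 0$. In case (ii) the denominator in the formula vanishes where $2\eta(x+\epsilon(x,t))-8\xi\eta t=0$, and $q$ is considered away from that set. *)

theory Defs
  imports "HOL-Analysis.Analysis"
begin

text \<open>
  Smoothness on a set \<open>S\<close>, which need not be open.  The derivatives are taken relative to \<open>S\<close>;
  they are unique when \<open>S\<close> is convex with nonempty interior, such as the closed half-plane
  \<open>t \<ge> 0\<close> used below, where derivatives at the boundary \<open>t = 0\<close> are one-sided in \<open>t\<close>.
\<close>

primrec Ck_on ::
  "nat \<Rightarrow> 'a::real_normed_vector set \<Rightarrow> ('a \<Rightarrow> 'b::real_normed_vector) \<Rightarrow> bool" where
  "Ck_on 0 S f \<longleftrightarrow> continuous_on S f"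
| "Ck_on (Suc k) S f \<longleftrightarrow>
     (\<exists>f'. (\<forall>p\<in>S. (f has_derivative f' p) (at p within S)) \<and> (\<forall>v. Ck_on k S (\<lambda>p. f' p v)))"

definition smooth_on ::
  "'a::real_normed_vector set \<Rightarrow> ('a \<Rightarrow> 'b::real_normed_vector) \<Rightarrow> bool" where
  "smooth_on S f \<longleftrightarrow> (\<forall>k. Ck_on k S f)"

text \<open>
  The Wadati-Konno-Ichikawa equation \<open>i q_t + (q / sqrt (1 + |q|^2))_xx = 0\<close> for all real \<open>x\<close>
  and all \<open>t \<ge> 0\<close>, including the existence of the derivatives occurring in it.
\<close>

definition WKI_solution :: "(real \<Rightarrow> real \<Rightarrow> complex) \<Rightarrow> bool" where
  "WKI_solution q \<longleftrightarrow>
     (\<exists>qt ux uxx. \<forall>x. \<forall>t\<ge>0.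
        ((\<lambda>s. q x s) has_vector_derivative qt x t) (at t within {0..}) \<and>
        ((\<lambda>y. q y t / complex_of_real (sqrt (1 + (cmod (q y t))\<^sup>2)))
           has_vector_derivative ux x t) (at x) \<and>
        ((\<lambda>y. ux y t) has_vector_derivative uxx x t) (at x) \<and>
        \<i> * qt x t + uxx x t = 0)"

definition eps_equation :: "real \<Rightarrow> real \<Rightarrow> real \<Rightarrow> real \<Rightarrow> real \<Rightarrow> bool" where
  "eps_equation \<xi> \<eta> x t e \<longleftrightarrow>
     e = \<eta> / (\<xi>\<^sup>2 + \<eta>\<^sup>2) * (tanh (2 * \<eta> * (x - 4 * \<xi> * t + e)) + 1)"

text \<open>
  Only meaningful where the implicit equation has exactly one solution, which fails for some
  \<open>(x, t)\<close> when \<open>|\<xi>| < |\<eta>|\<close>.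
\<close>

definition eps :: "real \<Rightarrow> real \<Rightarrow> real \<Rightarrow> real \<Rightarrow> real" where
  "eps \<xi> \<eta> x t = (THE e. eps_equation \<xi> \<eta> x t e)"

definition theta :: "real \<Rightarrow> real \<Rightarrow> real \<Rightarrow> real \<Rightarrow> real" where
  "theta \<xi> \<eta> x t = 2 * \<eta> * (x + eps \<xi> \<eta> x t) - 8 * \<xi> * \<eta> * t"

definition soliton :: "real \<Rightarrow> real \<Rightarrow> real \<Rightarrow> real \<Rightarrow> real \<Rightarrow> complex" where
  "soliton \<xi> \<eta> \<alpha> x t =
     2 * \<i> * complex_of_real (\<eta> / sqrt (\<xi>\<^sup>2 + \<eta>\<^sup>2))
     * exp (- \<i> * complex_of_real (- 2 * \<xi> * (x + eps \<xi> \<eta> x t) + 4 * (\<xi>\<^sup>2 - \<eta>\<^sup>2) * t))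
     * (cosh (complex_of_real (theta \<xi> \<eta> x t) + \<i> * complex_of_real \<alpha>)
        / complex_of_real ((cosh (theta \<xi> \<eta> x t))\<^sup>2 - 2 * \<eta>\<^sup>2 / (\<xi>\<^sup>2 + \<eta>\<^sup>2)))"

end

theory Submission
  imports Defs
begin

text \<open>
  Write \<open>s = \<eta>\<^sup>2 / (\<xi>\<^sup>2 + \<eta>\<^sup>2) = sin\<^sup>2 \<alpha>\<close> and \<open>\<theta> = 2 \<eta> (x - 4 \<xi> t + \<epsilon>)\<close>.  The implicit equation for
  \<open>\<epsilon>\<close> says exactly that \<open>\<theta> - 2 s (tanh \<theta> + 1) = 2 \<eta> (x - 4 \<xi> t)\<close>.  The left-hand side has
  derivative \<open>1 - 2 s / cosh\<^sup>2 \<theta>\<close>, so for \<open>2 s \<le> 1\<close>, that is \<open>|\<eta>| \<le> |\<xi>|\<close>, it is an increasing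
  bijection of the line (\<open>bij_phase_map\<close>).  Hence \<open>\<epsilon>\<close> is unique and \<open>\<theta>\<close> is a function of
  \<open>x - 4 \<xi> t\<close> alone.  Expressing \<open>x + \<epsilon>\<close> through \<open>\<theta>\<close> turns the phase of \<open>q\<close> into
  \<open>cot \<alpha> \<cdot> \<theta> + 4 (\<xi>\<^sup>2 + \<eta>\<^sup>2) t\<close>: the soliton is a travelling profile in \<open>\<theta>\<close> times a pure
  oscillation in \<open>t\<close> (\<open>soliton_eq\<close>).

  If \<open>2 s < 1\<close>, then \<open>\<theta>\<close> is differentiable with \<open>\<theta>\<^sub>x = 2 \<eta> cosh\<^sup>2 \<theta> / (cosh\<^sup>2 \<theta> - 2 s)\<close>, and
  \<open>1 + |q|\<^sup>2 = (cosh\<^sup>2 \<theta> / (cosh\<^sup>2 \<theta> - 2 s))\<^sup>2\<close> is a perfect square, so \<open>q / sqrt (1 + |q|\<^sup>2)\<close> arises from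
  \<open>q\<close> by replacing the denominator by \<open>cosh\<^sup>2 \<theta>\<close> (\<open>scaled_soliton_eq\<close>).  All terms of the
  differential equation are then rational in \<open>cosh \<theta>\<close>, \<open>sinh \<theta>\<close>, \<open>cos \<alpha>\<close>, \<open>sin \<alpha>\<close>, up to the
  common exponential factor, and cancel modulo \<open>cosh\<^sup>2 - sinh\<^sup>2 = 1\<close> and \<open>cos\<^sup>2 + sin\<^sup>2 = 1\<close>
  (\<open>profile_equation\<close>).  Smoothness follows because the functions that build \<open>q\<close> generate a ring
  that contains the directional derivatives of its elements (\<open>soliton_ring_closed\<close>).

  If \<open>2 s = 1\<close>, the denominator is \<open>sinh\<^sup>2 \<theta>\<close>, so \<open>|q| \<ge> 1 / sinh\<^sup>2 \<theta>\<close>; as \<open>\<theta>\<close> takes every real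
  value at each time, \<open>|q|\<close> is unbounded (\<open>soliton_unbounded\<close>).
\<close>

section \<open>Families closed under differentiation\<close>

text \<open>
  Reduces smoothness of a single function to first derivatives of a family: once the family
  reproduces itself under differentiation, no higher derivative has to be written down.
\<close>

lemma smooth_on_derivative_closed_family:
  assumes closed: "\<And>f. f \<in> F \<Longrightarrow>
      \<exists>f'. (\<forall>p\<in>S. (f has_derivative f' p) (at p within S)) \<and> (\<forall>v. (\<lambda>p. f' p v) \<in> F)"
    and "f \<in> F"
  shows "smooth_on S f"
proof -
  have "Ck_on k S f" if "f \<in> F" for k f
    using that
  proof (induction k arbitrary: f)
    case 0
    then show ?case
      using closed[OF 0] by (auto simp: continuous_on_eq_continuous_within
          intro: has_derivative_continuous)
  next
    case (Suc k)
    then show ?case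
      using closed[OF Suc.prems] by force
  qed
  with \<open>f \<in> F\<close> show ?thesis
    by (simp add: smooth_on_def)
qed

section \<open>The implicit equation\<close>

text \<open>The value of \<open>2 \<eta> (x - 4 \<xi> t)\<close> at the point where \<open>theta\<close> equals \<open>z\<close>.\<close>

definition phase_map :: "real \<Rightarrow> real \<Rightarrow> real" where
  "phase_map s z = z - 2 * s * (tanh z + 1)"

lemma DERIV_phase_map:
  "(phase_map s has_real_derivative 1 - 2 * s * (1 - (tanh z)\<^sup>2)) (at z)"
  unfolding phase_map_def [abs_def] by (auto intro!: derivative_eq_intros)

lemma continuous_on_phase_map: "continuous_on S (phase_map s)"
  using DERIV_phase_map by (meson DERIV_isCont continuous_at_imp_continuous_on)

lemma phase_map_deriv_pos:
  fixes s z :: real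
  assumes "0 \<le> s" "2 * s \<le> 1" "z \<noteq> 0"
  shows "0 < 1 - 2 * s * (1 - (tanh z)\<^sup>2)"
proof -
  have "\<bar>tanh z\<bar> < 1"
    using tanh_real_lt_1[of z] tanh_real_gt_neg1[of z] by linarith
  then have "(tanh z)\<^sup>2 < 1"
    by (simp add: abs_square_less_1)
  then have "2 * s * (1 - (tanh z)\<^sup>2) \<le> 1 * (1 - (tanh z)\<^sup>2)"
    using assms by (intro mult_right_mono) auto
  also have "\<dots> < 1"
    using assms by simp
  finally show ?thesis
    by simp
qed

text \<open>
  In the borderline case \<open>2 s = 1\<close> the derivative vanishes at \<open>0\<close>, so an interval around \<open>0\<close> is
  split there.
\<close>

lemma strict_mono_phase_map:
  assumes "0 \<le> s" "2 * s \<le> 1"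
  shows "strict_mono (phase_map s)"
proof (rule strict_monoI)
  fix a b :: real
  assume "a < b"
  have off_zero: "phase_map s u < phase_map s v" if "u < v" "0 \<le> u \<or> v \<le> 0" for u v
  proof (rule DERIV_pos_imp_increasing_open[OF \<open>u < v\<close>])
    fix z
    assume "u < z" "z < v"
    then have "z \<noteq> 0"
      using that by auto
    then show "\<exists>y. (phase_map s has_real_derivative y) (at z) \<and> 0 < y"
      using DERIV_phase_map phase_map_deriv_pos[OF assms] by blast
  qed (rule continuous_on_phase_map)
  show "phase_map s a < phase_map s b"
  proof (cases "0 \<le> a \<or> b \<le> 0")
    case True
    then show ?thesis
      using off_zero \<open>a < b\<close> by blast
  next
    case False
    then show ?thesis
      using off_zero[of a 0] off_zero[of 0 b] by simp
  qed
qed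

lemma bij_phase_map:
  assumes "0 \<le> s" "2 * s \<le> 1"
  shows "bij (phase_map s)"
proof (rule bijI)
  show "inj (phase_map s)"
    using strict_mono_phase_map[OF assms] by (rule strict_mono_imp_inj_on)
  show "surj (phase_map s)"
    unfolding surj_def
  proof
    fix y
    \<comment> \<open>Since \<open>0 < tanh + 1 < 2\<close>, the map moves points to the left by at most \<open>4 s\<close>.\<close>
    have "s * tanh (y + 4 * s) \<le> s * 1" "s * (- 1) \<le> s * tanh y"
      using tanh_real_lt_1[of "y + 4 * s"] tanh_real_gt_neg1[of y] assms
      by (intro mult_left_mono; simp)+
    then have "phase_map s y \<le> y" "y \<le> phase_map s (y + 4 * s)"
      by (simp_all add: phase_map_def algebra_simps)
    then have "\<exists>z\<ge>y. z \<le> y + 4 * s \<and> phase_map s z = y"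
      using assms by (intro IVT') (auto intro: continuous_on_phase_map)
    then show "\<exists>z. y = phase_map s z"
      by blast
  qed
qed

lemma DERIV_inv_phase_map:
  fixes s y :: real
  assumes "0 \<le> s" "2 * s < 1"
  defines "z \<equiv> inv (phase_map s) y"
  shows "(inv (phase_map s) has_real_derivative
           (cosh z)\<^sup>2 / ((cosh z)\<^sup>2 - 2 * s)) (at y)"
proof -
  let ?G = "inv (phase_map s)"
  have bij: "bij (phase_map s)"
    using bij_phase_map assms by simp
  have GH: "?G (phase_map s w) = w" for w
    using bij by (simp add: bij_is_inj)
  have HG: "phase_map s (?G w) = w" for w
    using bij by (simp add: bij_is_surj surj_f_inv_f)
  have "isCont ?G (phase_map s z)"
    by (rule isCont_inverse_function[where d=1])
       (auto simp: GH intro: DERIV_isCont DERIV_phase_map)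
  then have cont: "isCont ?G y"
    by (simp add: z_def HG)
  have C: "1 \<le> (cosh z)\<^sup>2"
    using cosh_real_ge_1[of z] by simp
  have slope: "1 - 2 * s * (1 - (tanh z)\<^sup>2) = ((cosh z)\<^sup>2 - 2 * s) / (cosh z)\<^sup>2"
  proof -
    have tanh_sq: "(tanh z)\<^sup>2 = ((cosh z)\<^sup>2 - 1) / (cosh z)\<^sup>2"
      by (simp add: tanh_def power_divide cosh_square_eq)
    moreover have "(cosh z)\<^sup>2 \<noteq> 0"
      using C by linarith
    ultimately show ?thesis
      unfolding tanh_sq by (simp add: field_simps)
  qed
  have "(?G has_real_derivative inverse (1 - 2 * s * (1 - (tanh z)\<^sup>2))) (at y)"
  proof (rule DERIV_inverse_function[where a = "y - 1" and b = "y + 1"])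
    show "(phase_map s has_real_derivative 1 - 2 * s * (1 - (tanh z)\<^sup>2)) (at (?G y))"
      unfolding z_def by (rule DERIV_phase_map)
    show "1 - 2 * s * (1 - (tanh z)\<^sup>2) \<noteq> 0"
      unfolding slope using C assms(2) by auto
  qed (use HG cont in auto)
  then show ?thesis
    by (simp add: slope)
qed

lemma eps_equation_iff_phase_map:
  assumes "\<eta> \<noteq> 0"
  shows "eps_equation \<xi> \<eta> x t e \<longleftrightarrow>
    phase_map (\<eta>\<^sup>2 / (\<xi>\<^sup>2 + \<eta>\<^sup>2)) (2 * \<eta> * (x - 4 * \<xi> * t + e)) = 2 * \<eta> * (x - 4 * \<xi> * t)"
    (is "_ \<longleftrightarrow> phase_map ?s ?z = _")
proof -
  have "phase_map ?s ?z - 2 * \<eta> * (x - 4 * \<xi> * t)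
      = 2 * \<eta> * (e - \<eta> / (\<xi>\<^sup>2 + \<eta>\<^sup>2) * (tanh ?z + 1))"
    unfolding phase_map_def by (simp add: algebra_simps power2_eq_square)
  then show ?thesis
    using assms by (auto simp: eps_equation_def)
qed

lemma eps_equation_unique_and_theta_eq:
  assumes "\<eta> \<noteq> 0" "\<bar>\<eta>\<bar> \<le> \<bar>\<xi>\<bar>"
  defines "s \<equiv> \<eta>\<^sup>2 / (\<xi>\<^sup>2 + \<eta>\<^sup>2)"
  shows "\<exists>!e. eps_equation \<xi> \<eta> x t e"
    and "theta \<xi> \<eta> x t = inv (phase_map s) (2 * \<eta> * (x - 4 * \<xi> * t))"
proof -
  let ?Y = "2 * \<eta> * (x - 4 * \<xi> * t)"
  have pos: "\<xi>\<^sup>2 + \<eta>\<^sup>2 > 0" and le: "\<eta>\<^sup>2 \<le> \<xi>\<^sup>2"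
    using assms by (auto simp: add_nonneg_pos abs_le_square_iff)
  have s: "0 \<le> s" "2 * s \<le> 1"
    using pos le by (simp_all add: s_def divide_simps)
  note bij = bij_phase_map[OF s]
  have eq_iff: "eps_equation \<xi> \<eta> x t e \<longleftrightarrow> 2 * \<eta> * (x - 4 * \<xi> * t + e) = inv (phase_map s) ?Y" for e
    using eps_equation_iff_phase_map[OF assms(1)] bij unfolding s_def
    by (metis bij_inv_eq_iff)
  show ex1: "\<exists>!e. eps_equation \<xi> \<eta> x t e"
    unfolding eq_iff
  proof (rule ex1I[of _ "inv (phase_map s) ?Y / (2 * \<eta>) - (x - 4 * \<xi> * t)"])
    show "2 * \<eta> * (x - 4 * \<xi> * t + (inv (phase_map s) ?Y / (2 * \<eta>) - (x - 4 * \<xi> * t)))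
        = inv (phase_map s) ?Y"
      using assms(1) by simp
  qed (use assms(1) in \<open>auto simp: field_simps\<close>)
  have "eps_equation \<xi> \<eta> x t (eps \<xi> \<eta> x t)"
    unfolding eps_def using ex1 by (rule theI')
  then show "theta \<xi> \<eta> x t = inv (phase_map s) ?Y"
    unfolding eq_iff by (simp add: theta_def algebra_simps)
qed

section \<open>The soliton as a modulated travelling wave\<close>

lemma cosh_of_real: "cosh (complex_of_real z) = complex_of_real (cosh z)"
  by (simp add: cosh_field_def exp_of_real flip: of_real_minus)

lemma sinh_of_real: "sinh (complex_of_real z) = complex_of_real (sinh z)"
  by (simp add: sinh_field_def exp_of_real flip: of_real_minus)

text \<open>
  As \<open>tan \<alpha> = \<eta> / \<xi>\<close> fixes \<open>\<alpha>\<close> only modulo \<open>\<pi>\<close>, the pair \<open>(\<xi>, \<eta>)\<close> is written in polar form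
  \<open>r (cos \<alpha>, sin \<alpha>)\<close> with a radius \<open>r\<close> of either sign.
\<close>

locale soliton_angle =
  fixes r \<alpha> :: real
  assumes r_nz: "r \<noteq> 0" and sin_nz: "sin \<alpha> \<noteq> 0" and half: "2 * (sin \<alpha>)\<^sup>2 \<le> 1"
begin

abbreviation "\<xi> \<equiv> r * cos \<alpha>"
abbreviation "\<eta> \<equiv> r * sin \<alpha>"
abbreviation "A \<equiv> complex_of_real (cos \<alpha>)"
abbreviation "B \<equiv> complex_of_real (sin \<alpha>)"
abbreviation "K \<equiv> 2 * \<i> * (complex_of_real (sgn r) * B)"
abbreviation "\<theta> \<equiv> theta \<xi> \<eta>"

definition carrier :: "real \<Rightarrow> complex" where
  "carrier t = exp (4 * \<i> * complex_of_real (r\<^sup>2) * complex_of_real t)"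

definition numer :: "complex \<Rightarrow> complex" where
  "numer z = A * cosh z + \<i> * B * sinh z"

definition denom :: "complex \<Rightarrow> complex" where
  "denom z = (cosh z)\<^sup>2 - 2 * B\<^sup>2"

definition wave :: "complex \<Rightarrow> complex" where
  "wave z = exp (\<i> * (A / B) * z)"

lemma AB: "A\<^sup>2 + B\<^sup>2 = 1"
  by (metis of_real_add of_real_power of_real_1 sin_cos_squared_add2 add.commute power2_eq_square)

lemma norm_sq: "\<xi>\<^sup>2 + \<eta>\<^sup>2 = r\<^sup>2"
  by (simp add: power_mult_distrib flip: distrib_left)

lemma s_eq: "\<eta>\<^sup>2 / (\<xi>\<^sup>2 + \<eta>\<^sup>2) = (sin \<alpha>)\<^sup>2"
  unfolding norm_sq using r_nz by (simp add: power_mult_distrib)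

lemma eta_le_xi: "\<bar>\<eta>\<bar> \<le> \<bar>\<xi>\<bar>"
proof -
  have "(sin \<alpha>)\<^sup>2 \<le> (cos \<alpha>)\<^sup>2"
    using half sin_cos_squared_add[of \<alpha>] by linarith
  then show ?thesis
    by (simp add: abs_mult mult_left_mono abs_le_square_iff)
qed

lemma theta_eq: "\<theta> x t = inv (phase_map ((sin \<alpha>)\<^sup>2)) (2 * \<eta> * (x - 4 * \<xi> * t))"
  using eps_equation_unique_and_theta_eq(2)[of \<eta> \<xi>] r_nz sin_nz eta_le_xi by (simp add: s_eq)

text \<open>
  Eliminating \<open>\<epsilon>\<close> by \<open>x + \<epsilon> = \<theta> / (2 \<eta>) + 4 \<xi> t\<close> separates the phase into a multiple of \<open>\<theta>\<close> and a
  multiple of \<open>t\<close>.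
\<close>

lemma soliton_eq:
  "soliton \<xi> \<eta> \<alpha> x t = K * carrier t * (wave (\<theta> x t) * numer (\<theta> x t) / denom (\<theta> x t))"
proof -
  let ?y = "x + eps \<xi> \<eta> x t"
  have theta: "\<theta> x t = 2 * \<eta> * ?y - 8 * \<xi> * \<eta> * t"
    by (simp add: theta_def)
  have "4 * r\<^sup>2 * t + cos \<alpha> / sin \<alpha> * \<theta> x t = - (- 2 * \<xi> * ?y + 4 * (\<xi>\<^sup>2 - \<eta>\<^sup>2) * t)"
    unfolding theta norm_sq[symmetric] using sin_nz by (simp add: field_simps power2_eq_square)
  then have "\<i> * complex_of_real (4 * r\<^sup>2 * t + cos \<alpha> / sin \<alpha> * \<theta> x t)
      = \<i> * complex_of_real (- (- 2 * \<xi> * ?y + 4 * (\<xi>\<^sup>2 - \<eta>\<^sup>2) * t))"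
    by (rule arg_cong)
  also have "\<dots> = - \<i> * complex_of_real (- 2 * \<xi> * ?y + 4 * (\<xi>\<^sup>2 - \<eta>\<^sup>2) * t)"
    by (simp only: of_real_minus mult_minus_left mult_minus_right)
  finally have "- \<i> * complex_of_real (- 2 * \<xi> * ?y + 4 * (\<xi>\<^sup>2 - \<eta>\<^sup>2) * t)
      = \<i> * complex_of_real (4 * r\<^sup>2 * t + cos \<alpha> / sin \<alpha> * \<theta> x t)"
    by (rule sym)
  then have phase: "exp (- \<i> * complex_of_real (- 2 * \<xi> * ?y + 4 * (\<xi>\<^sup>2 - \<eta>\<^sup>2) * t))
      = carrier t * wave (\<theta> x t)"
    by (simp only: carrier_def wave_def exp_add[symmetric]) (simp add: algebra_simps)
  have ampl: "\<eta> / sqrt (\<xi>\<^sup>2 + \<eta>\<^sup>2) = sgn r * sin \<alpha>"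
    unfolding norm_sq using r_nz by (simp add: sgn_if)
  have "cosh (complex_of_real (\<theta> x t) + \<i> * complex_of_real \<alpha>) = numer (\<theta> x t)"
    unfolding numer_def cosh_add
    by (simp add: sinh_conv_sin cosh_conv_cos sin_of_real cos_of_real mult.assoc[symmetric])
  moreover have "complex_of_real ((cosh (\<theta> x t))\<^sup>2 - 2 * \<eta>\<^sup>2 / (\<xi>\<^sup>2 + \<eta>\<^sup>2)) = denom (\<theta> x t)"
  proof -
    have "2 * \<eta>\<^sup>2 / (\<xi>\<^sup>2 + \<eta>\<^sup>2) = 2 * (sin \<alpha>)\<^sup>2"
      using s_eq by simp
    then show ?thesis
      by (simp only: denom_def cosh_of_real) simp
  qed
  ultimately show ?thesis
    unfolding soliton_def ampl phase by (simp only:) (simp add: mult_ac)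
qed

lemma cmod_carrier [simp]: "cmod (carrier t) = 1"
  by (simp add: carrier_def)

lemma cmod_wave [simp]: "cmod (wave (complex_of_real z)) = 1"
proof -
  have "\<i> * (A / B) * complex_of_real z = \<i> * complex_of_real (cos \<alpha> / sin \<alpha> * z)"
    by simp
  then show ?thesis
    unfolding wave_def by (simp only: norm_exp_i_times)
qed

lemma cmod_numer: "(cmod (numer (complex_of_real z)))\<^sup>2 = (cosh z)\<^sup>2 - (sin \<alpha>)\<^sup>2"
proof -
  have "numer (complex_of_real z) = Complex (cos \<alpha> * cosh z) (sin \<alpha> * sinh z)"
    by (simp add: numer_def complex_eq_iff cosh_of_real sinh_of_real)
  then have "(cmod (numer (complex_of_real z)))\<^sup>2 = (cos \<alpha> * cosh z)\<^sup>2 + (sin \<alpha> * sinh z)\<^sup>2"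
    by (simp add: cmod_power2)
  also have "\<dots> = (cosh z)\<^sup>2 - (sin \<alpha>)\<^sup>2"
    by (simp add: power_mult_distrib cosh_square_eq cos_squared_eq algebra_simps)
  finally show ?thesis .
qed

lemma denom_of_real:
  "denom (complex_of_real z) = complex_of_real ((cosh z)\<^sup>2 - 2 * (sin \<alpha>)\<^sup>2)"
  by (simp add: denom_def cosh_of_real)

lemma cmod_denom: "(cmod (denom (complex_of_real z)))\<^sup>2 = ((cosh z)\<^sup>2 - 2 * (sin \<alpha>)\<^sup>2)\<^sup>2"
  by (simp only: denom_of_real norm_of_real power2_abs)

lemma cmod_soliton:
  "(cmod (soliton \<xi> \<eta> \<alpha> x t))\<^sup>2 =
    4 * (sin \<alpha>)\<^sup>2 * ((cosh (\<theta> x t))\<^sup>2 - (sin \<alpha>)\<^sup>2) / ((cosh (\<theta> x t))\<^sup>2 - 2 * (sin \<alpha>)\<^sup>2)\<^sup>2"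
  using r_nz unfolding soliton_eq
  by (simp add: norm_mult norm_divide power_mult_distrib power_divide cmod_numer cmod_denom abs_sgn_eq)

text \<open>
  Here \<open>|q|\<^sup>2 = (2 sinh\<^sup>2 \<theta> + 1) / sinh\<^sup>4 \<theta>\<close>, which blows up at \<open>\<theta> = 0\<close>.
\<close>

lemma soliton_unbounded:
  assumes "2 * (sin \<alpha>)\<^sup>2 = 1"
  shows "\<not> bdd_above ((\<lambda>x. cmod (soliton \<xi> \<eta> \<alpha> x t)) ` {x. \<theta> x t \<noteq> 0})"
proof
  let ?q = "\<lambda>x. cmod (soliton \<xi> \<eta> \<alpha> x t)"
  assume "bdd_above (?q ` {x. \<theta> x t \<noteq> 0})"
  then obtain M where M: "?q x \<le> M" if "\<theta> x t \<noteq> 0" for x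
    by (auto simp: bdd_above_def)
  \<comment> \<open>\<open>w\<close> is the value of \<open>sinh\<^sup>2 \<theta>\<close> to aim for, chosen so that \<open>1 / w\<close> exceeds the bound, and
     \<open>x\<close> is the point where it is attained.\<close>
  define w where "w = 1 / (\<bar>M\<bar> + 1)"
  define z where "z = arsinh (sqrt w)"
  define x where "x = phase_map ((sin \<alpha>)\<^sup>2) z / (2 * \<eta>) + 4 * \<xi> * t"
  have s: "(sin \<alpha>)\<^sup>2 = 1 / 2"
    using assms by simp
  have w: "0 < w"
    by (simp add: w_def)
  have sinh_z: "(sinh z)\<^sup>2 = w"
    using w by (simp add: z_def sinh_arsinh_real)
  have "\<theta> x t = z"
    using bij_phase_map[of "(sin \<alpha>)\<^sup>2"] half r_nz sin_nz
    by (simp add: theta_eq x_def bij_is_inj)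
  moreover have "z \<noteq> 0"
    using w sinh_z by auto
  ultimately have "?q x \<le> M"
    using M by simp
  have "(1 / w)\<^sup>2 \<le> 2 * (w + 1 / 2) / w\<^sup>2"
    using w by (simp add: field_simps)
  also have "\<dots> = (?q x)\<^sup>2"
    unfolding cmod_soliton \<open>\<theta> x t = z\<close> cosh_square_eq sinh_z s by (simp add: algebra_simps)
  finally have "1 / w \<le> ?q x"
    by (rule power2_le_imp_le) simp
  with \<open>?q x \<le> M\<close> show False
    by (simp add: w_def)
qed

section \<open>The regular case\<close>

lemma DERIV_wave [derivative_intros]:
  "(f has_field_derivative f') (at z) \<Longrightarrow>
    ((\<lambda>z. wave (f z)) has_field_derivative wave (f z) * (\<i> * (A / B) * f')) (at z)"
  unfolding wave_def using sin_nz by (auto intro!: derivative_eq_intros)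

definition numer' :: "complex \<Rightarrow> complex" where
  "numer' z = A * sinh z + \<i> * B * cosh z"

lemma DERIV_numer [derivative_intros]:
  "(f has_field_derivative f') (at z) \<Longrightarrow>
    ((\<lambda>z. numer (f z)) has_field_derivative numer' (f z) * f') (at z)"
  unfolding numer_def numer'_def by (auto intro!: derivative_eq_intros simp: algebra_simps)

lemma DERIV_denom [derivative_intros]:
  "(f has_field_derivative f') (at z) \<Longrightarrow>
    ((\<lambda>z. denom (f z)) has_field_derivative 2 * cosh (f z) * sinh (f z) * f') (at z)"
  unfolding denom_def by (auto intro!: derivative_eq_intros)

text \<open>
  Up to constants and the exponential factors, \<open>flux / (cosh * denom)\<close> is the first
  \<open>x\<close>-derivative of \<open>q / sqrt (1 + |q|\<^sup>2)\<close>; see \<open>DERIV_scaled_profile\<close>.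
\<close>

definition flux :: "complex \<Rightarrow> complex" where
  "flux z = \<i> * ((cosh z)\<^sup>2 - 2 * B\<^sup>2 * (sinh z)\<^sup>2) - 2 * A * B * sinh z * cosh z"

definition flux' :: "complex \<Rightarrow> complex" where
  "flux' z = \<i> * (2 * cosh z * sinh z - 4 * B\<^sup>2 * sinh z * cosh z)
             - 2 * A * B * ((cosh z)\<^sup>2 + (sinh z)\<^sup>2)"

lemma DERIV_flux [derivative_intros]:
  "(f has_field_derivative f') (at z) \<Longrightarrow>
    ((\<lambda>z. flux (f z)) has_field_derivative flux' (f z) * f') (at z)"
  unfolding flux_def flux'_def
  by (auto intro!: derivative_eq_intros simp: algebra_simps power2_eq_square)

lemma B_nz: "B \<noteq> 0"
  using sin_nz by simp

definition profile' :: "complex \<Rightarrow> complex" where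
  "profile' z = wave z * (\<i> * A * numer z * denom z + B * numer' z * denom z
     - 2 * B * cosh z * sinh z * numer z) / (B * (denom z)\<^sup>2)"

lemma DERIV_profile:
  assumes "denom z \<noteq> 0"
  shows "((\<lambda>z. wave z * numer z / denom z) has_field_derivative profile' z) (at z)"
  unfolding profile'_def
  using assms B_nz
  by (auto intro!: derivative_eq_intros simp: divide_simps) (simp add: algebra_simps power2_eq_square)

text \<open>
  The quotient rule leaves \<open>cosh\<^sup>3\<close> in the denominator.  Multiplication by \<open>\<theta>\<^sub>x\<close>, which is
  proportional to \<open>cosh\<^sup>2 / denom\<close>, reduces it to \<open>cosh * denom\<close>.
\<close>

lemma DERIV_scaled_profile:
  assumes "cosh z \<noteq> 0"
  shows "((\<lambda>z. wave z * numer z / (cosh z)\<^sup>2) has_field_derivative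
     wave z * flux z / (B * cosh z ^ 3)) (at z)"
proof -
  have *: "\<i> * A * numer z * cosh z + B * numer' z * cosh z - 2 * B * numer z * sinh z = flux z"
    using AB cosh_square_eq[of z] i_squared
    unfolding numer_def numer'_def flux_def power2_eq_square by algebra
  show ?thesis
    unfolding *[symmetric] using assms B_nz
    by (auto intro!: derivative_eq_intros simp: divide_simps)
       (simp add: algebra_simps power2_eq_square power3_eq_cube power4_eq_xxxx)
qed

definition flux_profile' :: "complex \<Rightarrow> complex" where
  "flux_profile' z = wave z * (\<i> * A * flux z * cosh z * denom z + B * flux' z * cosh z * denom z
     - B * flux z * (sinh z * denom z + 2 * (cosh z)\<^sup>2 * sinh z)) / (B * (cosh z)\<^sup>2 * (denom z)\<^sup>2)"

lemma DERIV_flux_profile: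
  assumes "cosh z \<noteq> 0" "denom z \<noteq> 0"
  shows "((\<lambda>z. wave z * flux z / (cosh z * denom z)) has_field_derivative flux_profile' z) (at z)"
  unfolding flux_profile'_def
  using assms B_nz
  by (auto intro!: derivative_eq_intros simp: divide_simps) (simp add: algebra_simps power2_eq_square)

text \<open>
  The differential equation for \<open>q\<close> divided by \<open>4 r\<^sup>2\<close>, by the constant \<open>K\<close> and by the oscillation in
  \<open>t\<close>: the inner bracket is \<open>q\<^sub>t\<close>, its first term coming from the oscillation and its second
  from the motion of \<open>\<theta>\<close>, and the last summand is the second \<open>x\<close>-derivative.
\<close>

lemma profile_equation:
  assumes "cosh z \<noteq> 0" "denom z \<noteq> 0"
  shows "\<i> * (\<i> * (wave z * numer z / denom z) - 2 * A * B * ((cosh z)\<^sup>2 / denom z) * profile' z)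
    + B * ((cosh z)\<^sup>2 / denom z) * flux_profile' z = 0"
proof -
  define X where "X = \<i> * A * numer z * denom z + B * numer' z * denom z
     - 2 * B * cosh z * sinh z * numer z"
  define Y where "Y = \<i> * A * flux z * cosh z * denom z + B * flux' z * cosh z * denom z
     - B * flux z * (sinh z * denom z + 2 * (cosh z)\<^sup>2 * sinh z)"
  have cancel: "- numer z * (denom z)\<^sup>2 - 2 * \<i> * A * (cosh z)\<^sup>2 * X + Y = 0"
    using AB cosh_square_eq[of z] i_squared
    unfolding X_def Y_def numer_def numer'_def flux_def flux'_def denom_def power2_eq_square by algebra
  have "\<i> * (\<i> * (w * N / d) - 2 * A * B * (c\<^sup>2 / d) * (w * X / (B * d\<^sup>2)))
      + B * (c\<^sup>2 / d) * (w * Y / (B * c\<^sup>2 * d\<^sup>2)) = w / d ^ 3 * (- N * d\<^sup>2 - 2 * \<i> * A * c\<^sup>2 * X + Y)"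
    if "c \<noteq> 0" "d \<noteq> 0" for w N d c :: complex
    using that B_nz by (simp add: divide_simps) (simp add: algebra_simps power2_eq_square power3_eq_cube)
  from this[OF assms, of "wave z" "numer z"] show ?thesis
    unfolding profile'_def flux_profile'_def X_def[symmetric] Y_def[symmetric]
    by (simp only: cancel mult_zero_right)
qed

context
  assumes strict: "2 * (sin \<alpha>)\<^sup>2 < 1"
begin

lemma real_denom_pos: "0 < (cosh z)\<^sup>2 - 2 * (sin \<alpha>)\<^sup>2" for z :: real
  using strict cosh_real_ge_1[of z] one_le_power[of "cosh z" 2] by linarith

lemma denom_nz: "denom (complex_of_real z) \<noteq> 0"
  using real_denom_pos[of z] unfolding denom_of_real of_real_eq_0_iff by simp

lemma cosh_nz: "cosh (complex_of_real z) \<noteq> 0"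
  by (simp add: cosh_of_real)

text \<open>The derivative of the inverse of \<open>phase_map\<close> along the wave.\<close>

definition rate :: "real \<Rightarrow> real \<Rightarrow> real" where
  "rate x t = (cosh (\<theta> x t))\<^sup>2 / ((cosh (\<theta> x t))\<^sup>2 - 2 * (sin \<alpha>)\<^sup>2)"

lemma rate_complex:
  "complex_of_real (rate x t) = (cosh (complex_of_real (\<theta> x t)))\<^sup>2 / denom (\<theta> x t)"
  by (simp add: rate_def denom_of_real cosh_of_real)

lemma theta_has_derivative:
  "((\<lambda>p. \<theta> (fst p) (snd p)) has_derivative
     (\<lambda>v. (2 * \<eta> * (fst v - 4 * \<xi> * snd v)) * rate (fst p) (snd p))) (at p)"
  unfolding theta_eq[abs_def] rate_def
  by (rule DERIV_compose_FDERIV[OF DERIV_inv_phase_map])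
     (use strict in \<open>auto intro!: derivative_eq_intros\<close>)

lemma theta_DERIV_x: "((\<lambda>x. \<theta> x t) has_real_derivative 2 * \<eta> * rate x t) (at x)"
  unfolding theta_eq[abs_def] rate_def
  by (rule DERIV_cong[OF DERIV_chain2[OF DERIV_inv_phase_map]])
     (use strict in \<open>auto intro!: derivative_eq_intros\<close>)

lemma theta_DERIV_t: "((\<lambda>t. \<theta> x t) has_real_derivative - 8 * \<xi> * \<eta> * rate x t) (at t)"
  unfolding theta_eq[abs_def] rate_def
  by (rule DERIV_cong[OF DERIV_chain2[OF DERIV_inv_phase_map]])
     (use strict in \<open>auto intro!: derivative_eq_intros\<close>)

lemma has_vector_derivative_profile:
  assumes "(f has_field_derivative D) (at (complex_of_real (g y)))"
    and "(g has_real_derivative g') (at y)"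
  shows "((\<lambda>y. f (complex_of_real (g y))) has_vector_derivative g' * D) (at y)"
  using field_vector_diff_chain_at[OF has_vector_derivative_of_real[OF assms(2)] assms(1)]
  by (simp add: o_def)

lemma carrier_has_vector_derivative:
  "(carrier has_vector_derivative 4 * \<i> * complex_of_real (r\<^sup>2) * carrier t) (at t)"
  unfolding carrier_def
  by (rule has_vector_derivative_eq_rhs, rule has_vector_derivative_real_field)
     (auto intro!: derivative_eq_intros)

text \<open>
  The numerators combine because \<open>(C - 2 s)\<^sup>2 + 4 s (C - s) = C\<^sup>2\<close> for \<open>C = cosh\<^sup>2 \<theta>\<close>.
\<close>

lemma scaled_soliton_eq:
  "soliton \<xi> \<eta> \<alpha> x t / complex_of_real (sqrt (1 + (cmod (soliton \<xi> \<eta> \<alpha> x t))\<^sup>2))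
    = K * carrier t * (wave (\<theta> x t) * numer (\<theta> x t) / (cosh (complex_of_real (\<theta> x t)))\<^sup>2)"
proof -
  let ?C = "(cosh (\<theta> x t))\<^sup>2" and ?s = "(sin \<alpha>)\<^sup>2"
  have d: "0 < ?C - 2 * ?s"
    by (rule real_denom_pos)
  have "1 + (cmod (soliton \<xi> \<eta> \<alpha> x t))\<^sup>2 = (?C / (?C - 2 * ?s))\<^sup>2"
    using d unfolding cmod_soliton
    by (simp add: divide_simps) (simp add: power2_eq_square power4_eq_xxxx algebra_simps)
  then have "sqrt (1 + (cmod (soliton \<xi> \<eta> \<alpha> x t))\<^sup>2) = ?C / (?C - 2 * ?s)"
    using d by (simp add: real_sqrt_abs)
  then have "complex_of_real (sqrt (1 + (cmod (soliton \<xi> \<eta> \<alpha> x t))\<^sup>2))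
      = (cosh (complex_of_real (\<theta> x t)))\<^sup>2 / denom (\<theta> x t)"
    by (simp add: denom_of_real cosh_of_real)
  then show ?thesis
    using denom_nz[of "\<theta> x t"] by (simp add: soliton_eq)
qed

lemma soliton_WKI: "WKI_solution (soliton \<xi> \<eta> \<alpha>)"
proof -
  define F where "F z = wave z * numer z / denom z" for z
  define V where "V z = wave z * flux z / (cosh z * denom z)" for z
  define qt where "qt x t = K * (carrier t * (complex_of_real (- 8 * \<xi> * \<eta> * rate x t) * profile' (\<theta> x t))
      + 4 * \<i> * complex_of_real (r\<^sup>2) * carrier t * F (\<theta> x t))" for x t
  define ux where "ux x t = 2 * r * K * carrier t * V (\<theta> x t)" for x t
  define uxx where
    "uxx x t = 2 * r * K * carrier t * (complex_of_real (2 * \<eta> * rate x t) * flux_profile' (\<theta> x t))" for x t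
  have q: "soliton \<xi> \<eta> \<alpha> x = (\<lambda>t. K * (carrier t * F (\<theta> x t)))" for x
    unfolding F_def by (auto simp: soliton_eq mult.assoc)
  have dF: "(F has_field_derivative profile' (complex_of_real z)) (at (complex_of_real z))" for z
    unfolding F_def[abs_def] using DERIV_profile denom_nz by blast
  have dV: "(V has_field_derivative flux_profile' (complex_of_real z)) (at (complex_of_real z))" for z
    unfolding V_def[abs_def] using DERIV_flux_profile denom_nz cosh_nz by blast
  have 1: "((\<lambda>t. soliton \<xi> \<eta> \<alpha> x t) has_vector_derivative qt x t) (at t within {0..})" for x t
    unfolding q qt_def
    by (rule has_vector_derivative_at_within) (intro has_vector_derivative_mult_right
        has_vector_derivative_mult carrier_has_vector_derivative
        has_vector_derivative_profile[OF dF theta_DERIV_t])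
  have 2: "((\<lambda>y. soliton \<xi> \<eta> \<alpha> y t / complex_of_real (sqrt (1 + (cmod (soliton \<xi> \<eta> \<alpha> y t))\<^sup>2)))
      has_vector_derivative ux x t) (at x)" for x t
  proof -
    let ?z = "complex_of_real (\<theta> x t)"
    have "ux x t = K * carrier t * (complex_of_real (2 * \<eta> * rate x t) * (wave ?z * flux ?z / (B * cosh ?z ^ 3)))"
      unfolding ux_def V_def of_real_mult rate_complex using cosh_nz[of "\<theta> x t"] denom_nz[of "\<theta> x t"] B_nz
      by (simp add: field_simps power2_eq_square power3_eq_cube)
    then show ?thesis
      unfolding scaled_soliton_eq
      by (simp only:) (intro has_vector_derivative_mult_right
          has_vector_derivative_profile[OF DERIV_scaled_profile[OF cosh_nz] theta_DERIV_x])
  qed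
  have 3: "((\<lambda>y. ux y t) has_vector_derivative uxx x t) (at x)" for x t
    unfolding ux_def uxx_def
    by (intro has_vector_derivative_mult_right has_vector_derivative_profile[OF dV theta_DERIV_x])
  have 4: "\<i> * qt x t + uxx x t = 0" for x t
  proof -
    let ?z = "complex_of_real (\<theta> x t)"
    have "\<i> * qt x t + uxx x t = 4 * r\<^sup>2 * K * carrier t *
        (\<i> * (\<i> * F ?z - 2 * A * B * complex_of_real (rate x t) * profile' ?z)
          + B * complex_of_real (rate x t) * flux_profile' ?z)"
      unfolding qt_def uxx_def by (simp add: power2_eq_square algebra_simps)
    also have "\<dots> = 0"
      using profile_equation[OF cosh_nz denom_nz, of "\<theta> x t"]
      by (simp only: rate_complex F_def) simp
    finally show ?thesis .
  qed
  show ?thesis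
    unfolding WKI_solution_def using 1 2 3 4 by blast
qed

text \<open>
  The inverse of \<open>denom\<close> must be among the generators because it occurs in the derivative of \<open>\<theta>\<close>,
  and \<open>\<theta>\<close> enters only through the generators.
\<close>

inductive_set soliton_ring :: "(real \<times> real \<Rightarrow> complex) set" where
  const: "(\<lambda>p. c) \<in> soliton_ring"
| carrier: "(\<lambda>p. carrier (snd p)) \<in> soliton_ring"
| wave: "(\<lambda>p. wave (complex_of_real (\<theta> (fst p) (snd p)))) \<in> soliton_ring"
| cosh: "(\<lambda>p. cosh (complex_of_real (\<theta> (fst p) (snd p)))) \<in> soliton_ring"
| sinh: "(\<lambda>p. sinh (complex_of_real (\<theta> (fst p) (snd p)))) \<in> soliton_ring"
| denom: "(\<lambda>p. inverse (denom (complex_of_real (\<theta> (fst p) (snd p))))) \<in> soliton_ring"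
| add: "f \<in> soliton_ring \<Longrightarrow> g \<in> soliton_ring \<Longrightarrow> (\<lambda>p. f p + g p) \<in> soliton_ring"
| mult: "f \<in> soliton_ring \<Longrightarrow> g \<in> soliton_ring \<Longrightarrow> (\<lambda>p. f p * g p) \<in> soliton_ring"

text \<open>
  By the chain rule the directional derivative of a profile \<open>f\<close> along \<open>\<theta>\<close> is \<open>f'\<close> times the
  directional derivative of \<open>\<theta>\<close>, and the latter is a constant multiple of \<open>cosh\<^sup>2 / denom\<close>, which
  is in the ring.
\<close>

lemma soliton_ring_profile:
  assumes "\<And>z. (f has_field_derivative D (complex_of_real z)) (at (complex_of_real z))"
    and "(\<lambda>p. D (complex_of_real (\<theta> (fst p) (snd p)))) \<in> soliton_ring"
  shows "\<exists>f'. (\<forall>p. ((\<lambda>p. f (complex_of_real (\<theta> (fst p) (snd p)))) has_derivative f' p) (at p))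
    \<and> (\<forall>v. (\<lambda>p. f' p v) \<in> soliton_ring)"
proof (intro exI conjI allI)
  fix p :: "real \<times> real" and v :: "real \<times> real"
  let ?z = "\<lambda>p. complex_of_real (\<theta> (fst p) (snd p))"
  let ?f' = "\<lambda>p v. D (?z p) * ((cosh (?z p) * cosh (?z p)) * inverse (denom (?z p))
      * complex_of_real (2 * \<eta> * (fst v - 4 * \<xi> * snd v)))"
  have "((\<lambda>p. f (?z p)) has_derivative (\<lambda>v. D (?z p) * complex_of_real
      ((2 * \<eta> * (fst v - 4 * \<xi> * snd v)) * rate (fst p) (snd p)))) (at p)"
    using has_derivative_compose[OF has_derivative_of_real[OF theta_has_derivative]
        has_field_derivative_imp_has_derivative[OF assms(1)]] .
  then show "((\<lambda>p. f (?z p)) has_derivative ?f' p) (at p)"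
    by (rule has_derivative_eq_rhs)
       (simp only: of_real_mult rate_complex power2_eq_square divide_inverse mult_ac)
  show "(\<lambda>p. ?f' p v) \<in> soliton_ring"
    by (intro soliton_ring.intros assms(2))
qed

lemma soliton_ring_closed:
  assumes "f \<in> soliton_ring"
  shows "\<exists>f'. (\<forall>p. (f has_derivative f' p) (at p)) \<and> (\<forall>v. (\<lambda>p. f' p v) \<in> soliton_ring)"
  using assms
proof induction
  case (const c)
  show ?case
    by (rule exI[of _ "\<lambda>p v. 0"]) (auto intro: soliton_ring.const)
next
  case carrier
  have "((\<lambda>p. carrier (snd p)) has_derivative
      (\<lambda>v. complex_of_real (snd v) * (4 * \<i> * complex_of_real (r\<^sup>2) * carrier (snd p)))) (at p)"
    for p :: "real \<times> real"
    using has_derivative_compose[OF has_derivative_snd[OF has_derivative_ident]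
        carrier_has_vector_derivative[unfolded has_vector_derivative_def]]
    by (simp add: scaleR_conv_of_real)
  then show ?case
    by (intro exI[of _ "\<lambda>p v. complex_of_real (snd v) * (4 * \<i> * complex_of_real (r\<^sup>2) * carrier (snd p))"]
        conjI allI soliton_ring.intros)
next
  case wave
  show ?case
    by (rule soliton_ring_profile[where D = "\<lambda>z. wave z * (\<i> * (A / B))"], (auto intro!: derivative_eq_intros)[1])
       (intro soliton_ring.intros)
next
  case cosh
  show ?case
    by (rule soliton_ring_profile[where D = sinh], (auto intro!: derivative_eq_intros)[1])
       (intro soliton_ring.intros)
next
  case sinh
  show ?case
    by (rule soliton_ring_profile[where D = cosh], (auto intro!: derivative_eq_intros)[1])
       (intro soliton_ring.intros)
next
  case denom
  show ?case
  proof (rule soliton_ring_profile)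
    show "((\<lambda>z. inverse (denom z)) has_field_derivative
        - 2 * cosh (complex_of_real z) * sinh (complex_of_real z)
          * inverse (denom (complex_of_real z)) * inverse (denom (complex_of_real z)))
        (at (complex_of_real z))" for z
      using denom_nz[of z] by (auto intro!: derivative_eq_intros simp: field_simps)
  qed (intro soliton_ring.intros)
next
  case (add f g)
  then obtain f' g' where "(f has_derivative f' p) (at p)" "(\<lambda>p. f' p v) \<in> soliton_ring"
      "(g has_derivative g' p) (at p)" "(\<lambda>p. g' p v) \<in> soliton_ring" for p v
    by metis
  then show ?case
    by (intro exI[of _ "\<lambda>p v. f' p v + g' p v"] conjI allI soliton_ring.intros has_derivative_add)
next
  case (mult f g)
  then obtain f' g' where "(f has_derivative f' p) (at p)" "(\<lambda>p. f' p v) \<in> soliton_ring"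
      "(g has_derivative g' p) (at p)" "(\<lambda>p. g' p v) \<in> soliton_ring" for p v
    by metis
  then show ?case
    using mult
    by (intro exI[of _ "\<lambda>p v. f p * g' p v + f' p v * g p"] conjI allI soliton_ring.intros has_derivative_mult)
qed

lemma soliton_smooth: "smooth_on S (\<lambda>(x, t). soliton \<xi> \<eta> \<alpha> x t)"
proof (rule smooth_on_derivative_closed_family[where F = soliton_ring])
  show "\<exists>f'. (\<forall>p\<in>S. (f has_derivative f' p) (at p within S)) \<and> (\<forall>v. (\<lambda>p. f' p v) \<in> soliton_ring)"
    if "f \<in> soliton_ring" for f
    using soliton_ring_closed[OF that] has_derivative_at_withinI by blast
  have "(\<lambda>p. K * carrier (snd p) * (wave (complex_of_real (\<theta> (fst p) (snd p)))
      * (A * cosh (complex_of_real (\<theta> (fst p) (snd p))) + \<i> * B * sinh (complex_of_real (\<theta> (fst p) (snd p))))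
      * inverse (denom (complex_of_real (\<theta> (fst p) (snd p)))))) \<in> soliton_ring"
    by (intro soliton_ring.intros)
  then show "(\<lambda>(x, t). soliton \<xi> \<eta> \<alpha> x t) \<in> soliton_ring"
    by (simp only: soliton_eq numer_def case_prod_beta' divide_inverse)
qed

end

end

theorem mainTheorem4:
  fixes \<xi> \<eta> \<alpha> :: real
  assumes "tan \<alpha> = \<eta> / \<xi>"
  shows "(\<bar>\<xi>\<bar> > \<bar>\<eta>\<bar> \<and> \<bar>\<eta>\<bar> > 0 \<longrightarrow>
           (\<forall>x. \<forall>t\<ge>0. \<exists>!e. eps_equation \<xi> \<eta> x t e) \<and>
           smooth_on (UNIV \<times> {0..}) (\<lambda>(x, t). soliton \<xi> \<eta> \<alpha> x t) \<and>
           WKI_solution (soliton \<xi> \<eta> \<alpha>)) \<and>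
         (\<bar>\<xi>\<bar> = \<bar>\<eta>\<bar> \<and> \<bar>\<eta>\<bar> > 0 \<longrightarrow>
           (\<forall>x. \<forall>t\<ge>0. \<exists>!e. eps_equation \<xi> \<eta> x t e) \<and>
           (\<forall>t\<ge>0. \<not> bdd_above ((\<lambda>x. cmod (soliton \<xi> \<eta> \<alpha> x t)) ` {x. theta \<xi> \<eta> x t \<noteq> 0})))"
proof -
  have regime: "\<exists>r. soliton_angle r \<alpha> \<and> \<xi> = r * cos \<alpha> \<and> \<eta> = r * sin \<alpha>
      \<and> (\<bar>\<eta>\<bar> < \<bar>\<xi>\<bar> \<longrightarrow> 2 * (sin \<alpha>)\<^sup>2 < 1) \<and> (\<bar>\<xi>\<bar> = \<bar>\<eta>\<bar> \<longrightarrow> 2 * (sin \<alpha>)\<^sup>2 = 1)"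
    if "\<bar>\<eta>\<bar> \<le> \<bar>\<xi>\<bar>" "0 < \<bar>\<eta>\<bar>"
  proof -
    define r where "r = \<xi> / cos \<alpha>"
    have "\<xi> \<noteq> 0" "\<eta> \<noteq> 0"
      using that by auto
    then have "cos \<alpha> \<noteq> 0" "sin \<alpha> \<noteq> 0"
      using assms by (auto simp: tan_def)
    then have xi: "\<xi> = r * cos \<alpha>" and eta: "\<eta> = r * sin \<alpha>" and r: "r \<noteq> 0"
      using assms \<open>\<xi> \<noteq> 0\<close> by (auto simp: r_def tan_def field_simps)
    have le: "\<bar>sin \<alpha>\<bar> \<le> \<bar>cos \<alpha>\<bar>"
      using that(1) r by (simp add: xi eta abs_mult)
    have "(sin \<alpha>)\<^sup>2 \<le> (cos \<alpha>)\<^sup>2"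
      using le by (simp add: abs_le_square_iff)
    moreover have "(sin \<alpha>)\<^sup>2 < (cos \<alpha>)\<^sup>2" if "\<bar>\<eta>\<bar> < \<bar>\<xi>\<bar>"
      using that r abs_le_square_iff[of "cos \<alpha>" "sin \<alpha>"] by (simp add: xi eta abs_mult)
    moreover have "(sin \<alpha>)\<^sup>2 = (cos \<alpha>)\<^sup>2" if "\<bar>\<xi>\<bar> = \<bar>\<eta>\<bar>"
    proof -
      have "\<bar>sin \<alpha>\<bar> = \<bar>cos \<alpha>\<bar>"
        using that r by (simp add: xi eta abs_mult)
      then show ?thesis
        by (metis power2_abs)
    qed
    ultimately show ?thesis
      using xi eta r \<open>sin \<alpha> \<noteq> 0\<close>
      by (intro exI[of _ r]) (auto simp: soliton_angle_def cos_squared_eq)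
  qed
  have unique: "\<exists>!e. eps_equation \<xi> \<eta> x t e" if "\<bar>\<eta>\<bar> \<le> \<bar>\<xi>\<bar>" "0 < \<bar>\<eta>\<bar>" for x t
    using eps_equation_unique_and_theta_eq(1) that by auto
  show ?thesis
  proof (intro conjI impI; elim conjE)
    assume *: "\<bar>\<eta>\<bar> < \<bar>\<xi>\<bar>" "0 < \<bar>\<eta>\<bar>"
    with regime obtain r where r: "soliton_angle r \<alpha>" "\<xi> = r * cos \<alpha>" "\<eta> = r * sin \<alpha>"
        "2 * (sin \<alpha>)\<^sup>2 < 1"
      by auto
    show "\<forall>x. \<forall>t\<ge>0. \<exists>!e. eps_equation \<xi> \<eta> x t e"
      using unique * by simp
    show "smooth_on (UNIV \<times> {0..}) (\<lambda>(x, t). soliton \<xi> \<eta> \<alpha> x t)"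
      unfolding r(2,3) using r by (intro soliton_angle.soliton_smooth)
    show "WKI_solution (soliton \<xi> \<eta> \<alpha>)"
      unfolding r(2,3) using r by (intro soliton_angle.soliton_WKI)
  next
    assume *: "\<bar>\<xi>\<bar> = \<bar>\<eta>\<bar>" "0 < \<bar>\<eta>\<bar>"
    with regime obtain r where r: "soliton_angle r \<alpha>" "\<xi> = r * cos \<alpha>" "\<eta> = r * sin \<alpha>"
        "2 * (sin \<alpha>)\<^sup>2 = 1"
      by auto
    show "\<forall>x. \<forall>t\<ge>0. \<exists>!e. eps_equation \<xi> \<eta> x t e"
      using unique * by simp
    show "\<forall>t\<ge>0. \<not> bdd_above ((\<lambda>x. cmod (soliton \<xi> \<eta> \<alpha> x t)) ` {x. theta \<xi> \<eta> x t \<noteq> 0})"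
      unfolding r(2,3) using soliton_angle.soliton_unbounded[OF r(1,4)] by blast
  qed
qed

end
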